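(* Let $G$ be an additive subgroup of $\mathbb{F}_q$ with $|G|\ge 2$, let $\mathcal{A}=G^m$, and let $\mathbb{F}_{q'}$ be the largest subfield of $\mathbb{F}_q$ such that $G$ is an $\mathbb{F}_{q'}$-vector space. Let $L$ be a set of monomials in $\mathbb{F}_q[x_1,\ldots,x_m]$ of degree less than $|G|$ in every variable, closed under divisibility and having the Borel property. Then an affine transformation $T(x)=Mx+b$ lies in $\mathrm{Perm}_A(L(\mathcal{A}))$ if $b\in G^m$ and $M$ is a nonsingular lower triangular matrix with entries in $\mathbb{F}_{q'}$.
   Context: For a Cartesian set $\mathcal{A}=\prod_{i=1}^m A_i$ with $A_i\subseteq\mathbb{F}_q$, $n_i=|A_i|\ge 2$, $\Delta$ is the set of monomials $u$ with $\deg_{x_i}u<n_i$; for $L\subseteq\Delta$, $L(\mathcal{A})=\mathrm{Span}_{\mathbb{F}_q}\{(f(P_1),\ldots,f(P_n)) : f\in L\}$ where $\mathcal{A}=\{P_1,\ldots,P_n\}$. $I_{\mathcal{A}}=\left(\prod_{\alpha\in A_j}(x_j-\alpha)\right)_{j=1}^m$ and $\overline{g}$ is the unique element of $\mathrm{Span}_{\mathbb{F}_q}(\Delta)$ with $g-\overline{g}\in I_{\mathcal{A}}$. An affine transformation $T(x)=Mx+b$ ($M\in\mathbb{F}_q^{m\times m}$, $b\in\mathbb{F}_q^m$) acts on points by $P\mapsto MP+b$ and on polynomials by $T(f)=f(y_1,\ldots,y_m)$, $(y_1,\ldots,y_m)^t=M(x_1,\ldots,x_m)^t+b$. $T\in\mathrm{Perm}_A(L(\mathcal{A}))$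 means $T(\mathcal{A})=\mathcal{A}$ and $\overline{T(f)}\in\mathrm{Span}_{\mathbb{F}_q}(L)$ for all $f\in L$. $L$ has the Borel property if $u\in L$, $x_i\mid u$, $j<i$ imply $\frac{x_j}{x_i}u\in L$. (The paper denotes the matrix by $A$.) *)

theory Defs
  imports "HOL-Library.Poly_Mapping" "HOL-Analysis.Determinants"
begin

text \<open>
  The variables \<open>x\<^sub>1, \<dots>, x\<^sub>m\<close> are indexed by a finite linearly ordered type \<open>'n\<close>, so
  \<open>m = CARD('n)\<close>, and the ground field is a type of sort \<open>{field, finite}\<close>.
  A monomial is given by its exponent vector; products of monomials are sums of exponent vectors.
\<close>

type_synonym 'n monom = "'n \<Rightarrow>\<^sub>0 nat"
type_synonym ('n, 'a) mpol = "('n \<Rightarrow>\<^sub>0 nat) \<Rightarrow>\<^sub>0 'a"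

definition Const :: "'a::comm_ring_1 \<Rightarrow> ('n, 'a) mpol" where
  "Const c = Poly_Mapping.single 0 c"

definition Mono :: "'n monom \<Rightarrow> ('n, 'a::comm_ring_1) mpol" where
  "Mono u = Poly_Mapping.single u 1"

abbreviation var_exp :: "'n \<Rightarrow> 'n monom" where
  "var_exp i \<equiv> Poly_Mapping.single i 1"

abbreviation Var :: "'n \<Rightarrow> ('n, 'a::comm_ring_1) mpol" where
  "Var i \<equiv> Mono (var_exp i)"

definition mpol_span :: "('n, 'a::field) mpol set \<Rightarrow> ('n, 'a) mpol set" where
  "mpol_span = module.span (\<lambda>c p. Const c * p)"

lemma vector_space_mpol:
  "vector_space (\<lambda>(c::'a::field) (p::('n, 'a) mpol). Const c * p)"
  by unfold_locales
     (simp_all add: Const_def single_add distrib_left distrib_right mult_single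
        mult.assoc [symmetric])

definition subst_mpol ::
  "('n::finite \<Rightarrow> ('n, 'a::comm_ring_1) mpol) \<Rightarrow> ('n, 'a) mpol \<Rightarrow> ('n, 'a) mpol" where
  "subst_mpol y f =
     (\<Sum>u\<in>Poly_Mapping.keys f.
        Const (Poly_Mapping.lookup f u) * (\<Prod>i\<in>UNIV. y i ^ Poly_Mapping.lookup u i))"

definition cart_set :: "('n::finite \<Rightarrow> 'a set) \<Rightarrow> ('a ^ 'n) set" where
  "cart_set A = {P. \<forall>i. P $ i \<in> A i}"

definition Delta :: "('n \<Rightarrow> 'a set) \<Rightarrow> 'n monom set" where
  "Delta A = {u. \<forall>i. Poly_Mapping.lookup u i < card (A i)}"

definition cart_ideal :: "('n::finite \<Rightarrow> 'a::field set) \<Rightarrow> ('n, 'a) mpol set" where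
  "cart_ideal A = {\<Sum>j\<in>UNIV. h j * (\<Prod>\<alpha>\<in>A j. Var j - Const \<alpha>) |h. True}"

definition reduce :: "('n::finite \<Rightarrow> 'a::field set) \<Rightarrow> ('n, 'a) mpol \<Rightarrow> ('n, 'a) mpol" where
  "reduce A g = (THE r. r \<in> mpol_span (Mono ` Delta A) \<and> g - r \<in> cart_ideal A)"

text \<open>The affine transformation \<open>T(x) = M x + b\<close> is represented by the pair \<open>(M, b)\<close>.\<close>

definition aff_point :: "'a::comm_ring_1 ^ 'n ^ 'n \<Rightarrow> 'a ^ 'n \<Rightarrow> 'a ^ 'n \<Rightarrow> 'a ^ 'n" where
  "aff_point M b P = M *v P + b"

definition aff_mpol ::
  "'a::comm_ring_1 ^ 'n ^ 'n \<Rightarrow> 'a ^ 'n \<Rightarrow> ('n::finite, 'a) mpol \<Rightarrow> ('n, 'a) mpol" where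
  "aff_mpol M b = subst_mpol (\<lambda>i. (\<Sum>j\<in>UNIV. Const (M $ i $ j) * Var j) + Const (b $ i))"

definition Perm_A ::
  "('n::finite \<Rightarrow> 'a::field set) \<Rightarrow> 'n monom set \<Rightarrow> (('a ^ 'n ^ 'n) \<times> ('a ^ 'n)) set" where
  "Perm_A A L = {(M, b). aff_point M b ` cart_set A = cart_set A \<and>
     (\<forall>f\<in>Mono ` L. reduce A (aff_mpol M b f) \<in> mpol_span (Mono ` L))}"

definition monom_dvd :: "'n monom \<Rightarrow> 'n monom \<Rightarrow> bool" where
  "monom_dvd v u \<longleftrightarrow> (\<exists>w. u = v + w)"

definition closed_under_divisors :: "'n monom set \<Rightarrow> bool" where
  "closed_under_divisors L \<longleftrightarrow> (\<forall>u\<in>L. \<forall>v. monom_dvd v u \<longrightarrow> v \<in> L)"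

text \<open>
  The truncated subtraction below is exact, as \<open>x\<^sub>i\<close> divides \<open>u\<close>. The monomial \<open>(x\<^sub>j / x\<^sub>i) u\<close> is
  required to lie in \<open>L\<close> without the proviso that it has small degree in \<open>x\<^sub>j\<close>.
\<close>

definition borel_property :: "'n::linorder monom set \<Rightarrow> bool" where
  "borel_property L \<longleftrightarrow>
     (\<forall>u\<in>L. \<forall>i j. monom_dvd (var_exp i) u \<and> j < i \<longrightarrow> (u - var_exp i) + var_exp j \<in> L)"

definition add_subgroup :: "'a::ab_group_add set \<Rightarrow> bool" where
  "add_subgroup G \<longleftrightarrow> 0 \<in> G \<and> (\<forall>x\<in>G. \<forall>y\<in>G. x + y \<in> G) \<and> (\<forall>x\<in>G. - x \<in> G)"

definition is_subfield :: "'a::field set \<Rightarrow> bool" where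
  "is_subfield K \<longleftrightarrow> add_subgroup K \<and> 1 \<in> K \<and> (\<forall>x\<in>K. \<forall>y\<in>K. x * y \<in> K) \<and>
     (\<forall>x\<in>K. x \<noteq> 0 \<longrightarrow> inverse x \<in> K)"

definition is_vector_space_over :: "'a::field set \<Rightarrow> 'a set \<Rightarrow> bool" where
  "is_vector_space_over K G \<longleftrightarrow> add_subgroup G \<and> (\<forall>c\<in>K. \<forall>x\<in>G. c * x \<in> G)"

definition largest_scalar_subfield :: "'a::field set \<Rightarrow> 'a set \<Rightarrow> bool" where
  "largest_scalar_subfield K G \<longleftrightarrow> is_subfield K \<and> is_vector_space_over K G \<and>
     (\<forall>K'. is_subfield K' \<and> is_vector_space_over K' G \<longrightarrow> K' \<subseteq> K)"

definition lower_triangular :: "'a::zero ^ ('n::{finite, linorder}) ^ ('n::{finite, linorder}) \<Rightarrow> bool" where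
  "lower_triangular M \<longleftrightarrow> (\<forall>i j. i < j \<longrightarrow> M $ i $ j = 0)"

end

theory Submission
  imports Defs "HOL-Computational_Algebra.Polynomial"
begin

text \<open>
  Expanding \<open>T(x\<^sup>u)\<close> replaces each factor \<open>x\<^sub>i\<close> of \<open>x\<^sup>u\<close> by some \<open>x\<^sub>j\<close> with \<open>j \<le> i\<close> or by a constant, so by
  the Borel property and closure under divisors every monomial obtained already lies in \<open>L\<close>. Hence
  \<open>T(x\<^sup>u)\<close> is its own reduction, because an element of \<open>Span(\<Delta>)\<close> that vanishes on the grid is zero.
  The map \<open>T\<close> permutes \<open>G\<^sup>m\<close> since it is injective and maps this finite set into itself.
\<close>

section \<open>Expansion into terms and spans of monomials\<close>

lemma Const_mult_Mono: "Const c * Mono u = Poly_Mapping.single u c"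
  by (simp add: Const_def Mono_def mult_single)

lemma mpol_eq_sum_single:
  "p = (\<Sum>u\<in>Poly_Mapping.keys p. Poly_Mapping.single u (Poly_Mapping.lookup p u))"
proof (rule poly_mapping_eqI)
  fix v
  have "(\<Sum>u\<in>Poly_Mapping.keys p. Poly_Mapping.lookup (Poly_Mapping.single u (Poly_Mapping.lookup p u)) v)
    = (\<Sum>u\<in>Poly_Mapping.keys p. if u = v then Poly_Mapping.lookup p v else 0)"
    by (intro sum.cong) (auto simp: lookup_single when_def)
  then show "Poly_Mapping.lookup p v = Poly_Mapping.lookup
      (\<Sum>u\<in>Poly_Mapping.keys p. Poly_Mapping.single u (Poly_Mapping.lookup p u)) v"
    by (simp add: lookup_sum not_in_keys_iff_lookup_eq_zero in_keys_iff)
qed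

text \<open>Polynomials supported in \<open>L\<close> form a subspace containing these monomials,
  and each is the combination of its own terms. Both \<open>reduce\<close> and \<open>Perm_A\<close>
  thereby become statements about supports.\<close>

lemma mpol_span_Mono: "mpol_span (Mono ` L) = {p. Poly_Mapping.keys p \<subseteq> L}"
proof -
  interpret vector_space "\<lambda>(c::'b::field) (p::('a, 'b) mpol). Const c * p"
    by (rule vector_space_mpol)
  have "span (Mono ` L) \<subseteq> {p. Poly_Mapping.keys p \<subseteq> L}"
  proof (rule span_minimal)
    show "Mono ` L \<subseteq> {p. Poly_Mapping.keys p \<subseteq> L}"
      by (auto simp: Mono_def)
    show "subspace {p. Poly_Mapping.keys p \<subseteq> L}"
      unfolding subspace_def
    proof (intro conjI ballI allI; clarify?)
      fix c :: 'b and p :: "('a, 'b) mpol" and v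
      assume "Poly_Mapping.keys p \<subseteq> L" and "v \<in> Poly_Mapping.keys (Const c * p)"
      then show "v \<in> L"
        using keys_mult[of "Const c" p] by (auto simp: Const_def split: if_splits)
    next
      fix p q :: "('a, 'b) mpol" and v
      assume "Poly_Mapping.keys p \<subseteq> L" "Poly_Mapping.keys q \<subseteq> L"
        and "v \<in> Poly_Mapping.keys (p + q)"
      then show "v \<in> L"
        using Poly_Mapping.keys_add[of p q] by auto
    qed simp
  qed
  moreover have "p \<in> span (Mono ` L)" if "Poly_Mapping.keys p \<subseteq> L" for p :: "('a, 'b) mpol"
  proof -
    have "(\<Sum>u\<in>Poly_Mapping.keys p. Const (Poly_Mapping.lookup p u) * Mono u) \<in> span (Mono ` L)"
      using that by (intro span_sum span_scale span_base imageI) auto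
    then show ?thesis
      by (simp only: Const_mult_Mono mpol_eq_sum_single[symmetric])
  qed
  ultimately show ?thesis
    by (auto simp: mpol_span_def)
qed

section \<open>Evaluation of polynomials at points\<close>

text \<open>Points are functions rather than vectors, to match the extensional products in
  \<open>grid_coeff_zero\<close>.\<close>

definition eval_mpol :: "('n::finite \<Rightarrow> 'a) \<Rightarrow> ('n, 'a::comm_ring_1) mpol \<Rightarrow> 'a" where
  "eval_mpol x p = (\<Sum>u\<in>Poly_Mapping.keys p.
     Poly_Mapping.lookup p u * (\<Prod>i\<in>UNIV. x i ^ Poly_Mapping.lookup u i))"

lemma eval_mpol_superset:
  assumes "finite S" "Poly_Mapping.keys p \<subseteq> S"
  shows "eval_mpol x p = (\<Sum>u\<in>S. Poly_Mapping.lookup p u * (\<Prod>i\<in>UNIV. x i ^ Poly_Mapping.lookup u i))"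
  unfolding eval_mpol_def
  using assms by (intro sum.mono_neutral_left) (auto simp: in_keys_iff)

lemma eval_mpol_add: "eval_mpol x (p + q) = eval_mpol x p + eval_mpol x q"
proof -
  let ?S = "Poly_Mapping.keys p \<union> Poly_Mapping.keys q"
  have "Poly_Mapping.keys (p + q) \<subseteq> ?S"
    by (rule Poly_Mapping.keys_add)
  then show ?thesis
    by (simp add: eval_mpol_superset[of ?S] lookup_add distrib_right sum.distrib)
qed

lemma eval_mpol_zero [simp]: "eval_mpol x 0 = 0"
  by (simp add: eval_mpol_def)

lemma eval_mpol_diff: "eval_mpol x (p - q) = eval_mpol x p - eval_mpol x q"
  using eval_mpol_add[of x "p - q" q] by simp

lemma eval_mpol_sum: "eval_mpol x (sum f S) = (\<Sum>i\<in>S. eval_mpol x (f i))"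
  by (induction S rule: infinite_finite_induct) (simp_all add: eval_mpol_add)

lemma eval_mpol_single:
  "eval_mpol x (Poly_Mapping.single u c) = c * (\<Prod>i\<in>UNIV. x i ^ Poly_Mapping.lookup u i)"
  by (simp add: eval_mpol_def)

lemma eval_mpol_mult: "eval_mpol x (p * q) = eval_mpol x p * eval_mpol x q"
proof -
  have single: "eval_mpol x (Poly_Mapping.single u c * Poly_Mapping.single v d) =
      eval_mpol x (Poly_Mapping.single u c) * eval_mpol x (Poly_Mapping.single v d)" for u v c d
    by (simp add: mult_single eval_mpol_single lookup_add power_add prod.distrib ac_simps)
  show ?thesis
    \<comment> \<open>Both occurrences of each factor are expanded into terms, so bilinearity leaves
      only \<open>single\<close>.\<close>
    by (subst (1 2) mpol_eq_sum_single[of p], subst (1 2) mpol_eq_sum_single[of q])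
       (simp only: sum_product eval_mpol_sum single)
qed

lemma eval_mpol_Const: "eval_mpol x (Const c) = c"
  by (simp add: Const_def eval_mpol_single)

lemma eval_mpol_Var: "eval_mpol x (Var i) = x i"
proof -
  have "(\<Prod>j\<in>UNIV. x j ^ Poly_Mapping.lookup (var_exp i) j) = (\<Prod>j\<in>UNIV. if j = i then x j else 1)"
    by (intro prod.cong) (auto simp: lookup_single when_def)
  then show ?thesis
    by (simp add: Mono_def eval_mpol_single)
qed

text \<open>In the \<open>j\<close>-th generator the factor with \<open>\<alpha> = x j\<close>
  vanishes at \<open>x\<close>; finiteness of \<open>A j\<close> allows it to be split off the
  product.\<close>

lemma eval_mpol_cart_ideal:
  assumes p: "p \<in> cart_ideal A" and fin: "\<And>i. finite (A i)" and x: "\<And>i. x i \<in> A i"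
  shows "eval_mpol x p = 0"
proof -
  have "eval_mpol x (h * (\<Prod>\<alpha>\<in>A j. Var j - Const \<alpha>)) = 0" for h j
    by (subst prod.remove[OF fin x[of j]])
       (simp add: eval_mpol_mult eval_mpol_diff eval_mpol_Var eval_mpol_Const del: One_nat_def)
  then show ?thesis
    using p by (auto simp: cart_ideal_def eval_mpol_sum)
qed

section \<open>Polynomials of small degree vanishing on a grid\<close>

lemma coeff_zero_if_many_roots:
  fixes c :: "nat \<Rightarrow> 'a::idom"
  assumes "\<And>x. x \<in> A \<Longrightarrow> (\<Sum>k<card A. c k * x ^ k) = 0" and k: "k < card A"
  shows "c k = 0"
proof -
  define p where "p = (\<Sum>k<card A. monom (c k) k)"
  have coeff: "coeff p j = (if j < card A then c j else 0)" for j
    by (simp add: p_def coeff_sum coeff_monom)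
  have "degree p < card A"
    using k by (intro degree_lessI) (auto simp: coeff)
  then have "p = 0"
    using assms(1) by (intro poly_eqI_degree[of A]) (auto simp: p_def poly_sum poly_monom)
  then show ?thesis
    using coeff[of k] k by simp
qed

text \<open>Induction on the set of variables: in the inserted variable the sum is a univariate
  polynomial, whose coefficients are sums of the same shape in the remaining variables.\<close>

lemma grid_coeff_zero:
  fixes c :: "('n \<Rightarrow> nat) \<Rightarrow> 'a::idom"
  assumes "finite S"
    and "\<And>x. x \<in> Pi\<^sub>E S A \<Longrightarrow>
           (\<Sum>e\<in>(\<Pi>\<^sub>E i\<in>S. {..<card (A i)}). c e * (\<Prod>i\<in>S. x i ^ e i)) = 0"
    and "e \<in> (\<Pi>\<^sub>E i\<in>S. {..<card (A i)})"
  shows "c e = 0"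
  using assms
proof (induction S arbitrary: c e rule: finite_induct)
  case empty
  then show ?case by simp
next
  case (insert i S)
  let ?E = "\<Pi>\<^sub>E j\<in>S. {..<card (A j)}"
  have zero: "c (d(i := k)) = 0" if d: "d \<in> ?E" and k: "k < card (A i)" for d k
  proof (rule insert.IH[of "\<lambda>d. c (d(i := k))"])
    fix x assume x: "x \<in> Pi\<^sub>E S A"
    show "(\<Sum>d\<in>?E. c (d(i := k)) * (\<Prod>j\<in>S. x j ^ d j)) = 0"
    \<comment> \<open>With \<open>x\<close> fixed and only the coordinate \<open>z\<close> varying,
      the sum over \<open>?E\<close> is the coefficient of \<open>z ^ k\<close>.\<close>
    proof (rule coeff_zero_if_many_roots[OF _ k, where c = "\<lambda>k. \<Sum>d\<in>?E. c (d(i := k)) * (\<Prod>j\<in>S. x j ^ d j)"])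
      fix z assume z: "z \<in> A i"
      have "x(i := z) \<in> Pi\<^sub>E (insert i S) A"
        using z x by (rule PiE_fun_upd)
      then have "0 = (\<Sum>e\<in>(\<Pi>\<^sub>E j\<in>insert i S. {..<card (A j)}).
          c e * (\<Prod>j\<in>insert i S. (x(i := z)) j ^ e j))"
        by (rule insert.prems(1)[symmetric])
      \<comment> \<open>An exponent function on \<open>insert i S\<close> is split into its value
        \<open>k\<close> at \<open>i\<close> and its restriction \<open>d\<close> to
        \<open>S\<close>.\<close>
      also have "\<dots> = (\<Sum>(k, d)\<in>{..<card (A i)} \<times> ?E.
          c (d(i := k)) * (\<Prod>j\<in>insert i S. (x(i := z)) j ^ (d(i := k)) j))"
        unfolding PiE_insert_eq
        by (subst sum.reindex[OF inj_combinator[OF insert.hyps(2)]]) (simp add: split_beta)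
      also have "\<dots> = (\<Sum>(k, d)\<in>{..<card (A i)} \<times> ?E.
          c (d(i := k)) * (\<Prod>j\<in>S. x j ^ d j) * z ^ k)"
      proof (intro sum.cong refl, clarify)
        fix k d
        have "(\<Prod>j\<in>S. (x(i := z)) j ^ (d(i := k)) j) = (\<Prod>j\<in>S. x j ^ d j)"
          using insert.hyps by (intro prod.cong) auto
        then show "c (d(i := k)) * (\<Prod>j\<in>insert i S. (x(i := z)) j ^ (d(i := k)) j)
            = c (d(i := k)) * (\<Prod>j\<in>S. x j ^ d j) * z ^ k"
          using insert.hyps by (simp add: ac_simps)
      qed
      finally show "(\<Sum>k<card (A i). (\<Sum>d\<in>?E. c (d(i := k)) * (\<Prod>j\<in>S. x j ^ d j)) * z ^ k) = 0"
        by (simp add: sum.cartesian_product sum_distrib_right)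
    qed
  qed (rule d)
  show ?case
    using insert.prems(2) zero unfolding PiE_insert_eq by auto
qed

lemma mpol_zero_if_vanishing_on_grid:
  fixes p :: "('n::finite, 'a::idom) mpol"
  assumes keys: "Poly_Mapping.keys p \<subseteq> Delta A"
    and van: "\<And>x. (\<And>i. x i \<in> A i) \<Longrightarrow> eval_mpol x p = 0"
  shows "p = 0"
proof (rule poly_mapping_eqI)
  fix u
  let ?E = "\<Pi>\<^sub>E i\<in>(UNIV :: 'n set). {..<card (A i)}"
  \<comment> \<open>Over a finite index type every exponent function has finite support, and
    extensionality on \<open>UNIV\<close> is no restriction, so \<open>Abs_poly_mapping\<close>
    inverts \<open>lookup\<close>.\<close>
  have bij: "bij_betw Poly_Mapping.lookup (Delta A) ?E"
  proof (rule bij_betwI[where g = Abs_poly_mapping])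
    show "Abs_poly_mapping \<in> ?E \<rightarrow> Delta A"
      by (auto simp: Delta_def PiE_def Pi_def)
  qed (auto simp: Delta_def PiE_def Pi_def extensional_def)
  have "finite ?E"
    by (intro finite_PiE) auto
  then have fin: "finite (Delta A)"
    using bij by (simp add: bij_betw_finite)
  show "Poly_Mapping.lookup p u = Poly_Mapping.lookup 0 u"
  proof (cases "u \<in> Delta A")
    case True
    have "(\<lambda>e. Poly_Mapping.lookup p (Abs_poly_mapping e)) (Poly_Mapping.lookup u) = 0"
    proof (rule grid_coeff_zero[of UNIV A])
      fix x assume "x \<in> Pi\<^sub>E UNIV A"
      then have "0 = eval_mpol x p"
        using van by (simp add: PiE_def Pi_def)
      also have "\<dots> = (\<Sum>u\<in>Delta A. Poly_Mapping.lookup p u * (\<Prod>i\<in>UNIV. x i ^ Poly_Mapping.lookup u i))"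
        by (rule eval_mpol_superset[OF fin keys])
      also have "\<dots> = (\<Sum>e\<in>?E. Poly_Mapping.lookup p (Abs_poly_mapping e) * (\<Prod>i\<in>UNIV. x i ^ e i))"
        by (subst sum.reindex_bij_betw[OF bij, symmetric]) simp
      finally show "(\<Sum>e\<in>?E. Poly_Mapping.lookup p (Abs_poly_mapping e) * (\<Prod>i\<in>UNIV. x i ^ e i)) = 0"
        by simp
    qed (use True bij in \<open>auto dest: bij_betwE\<close>)
    then show ?thesis
      by simp
  next
    case False
    then show ?thesis
      using keys by (auto simp: in_keys_iff)
  qed
qed

text \<open>The candidate \<open>r\<close> works because \<open>r - r = 0\<close> is in the ideal.
  For another candidate \<open>s\<close>, the difference \<open>r - s\<close> is supported in
  \<open>Delta A\<close> and vanishes on the grid, hence is zero.\<close>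

lemma reduce_eqI:
  fixes A :: "'n::finite \<Rightarrow> 'a::field set"
  assumes fin: "\<And>i. finite (A i)" and r: "Poly_Mapping.keys r \<subseteq> Delta A"
  shows "reduce A r = r"
  unfolding reduce_def mpol_span_Mono
proof (rule the_equality)
  have "0 \<in> cart_ideal A"
    unfolding cart_ideal_def by (intro CollectI exI[of _ "\<lambda>_. 0"]) simp
  then show "r \<in> {p. Poly_Mapping.keys p \<subseteq> Delta A} \<and> r - r \<in> cart_ideal A"
    using r by simp
next
  fix s assume s: "s \<in> {p. Poly_Mapping.keys p \<subseteq> Delta A} \<and> r - s \<in> cart_ideal A"
  have "r - s = 0"
  proof (rule mpol_zero_if_vanishing_on_grid[of _ A])
    show "Poly_Mapping.keys (r - s) \<subseteq> Delta A"
      using r s keys_diff[of r s] by auto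
  qed (use s fin in \<open>auto intro: eval_mpol_cart_ideal\<close>)
  then show "s = r"
    by simp
qed

section \<open>Supports under triangular substitution\<close>

text \<open>Induction on the total degree of \<open>u\<close>. The polynomial \<open>p\<close>
  accumulates the factors already substituted, while \<open>u\<close> records those still to be
  replaced; the hypothesis on \<open>v + u\<close> is the invariant.\<close>

lemma keys_mult_triangular_prod:
  fixes L :: "'n::{finite, linorder} monom set" and y :: "'n \<Rightarrow> ('n, 'a::comm_ring_1) mpol"
  assumes div: "closed_under_divisors L" and borel: "borel_property L"
    and y: "\<And>i. Poly_Mapping.keys (y i) \<subseteq> insert 0 (var_exp ` {..i})"
    and "\<And>v. v \<in> Poly_Mapping.keys p \<Longrightarrow> v + u \<in> L"
  shows "Poly_Mapping.keys (p * (\<Prod>i\<in>UNIV. y i ^ Poly_Mapping.lookup u i)) \<subseteq> L"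
  using assms(4)
proof (induction "\<Sum>i\<in>UNIV. Poly_Mapping.lookup u i" arbitrary: u p)
  case 0
  then have "u = 0"
    by (intro poly_mapping_eqI) simp
  then show ?case
    using 0(2) by auto
next
  case (Suc n)
  have "\<exists>i. Poly_Mapping.lookup u i \<noteq> 0"
    using Suc.hyps(2) by (metis nat.distinct(1) sum.neutral)
  then obtain i where i: "Poly_Mapping.lookup u i \<noteq> 0"
    by blast
  \<comment> \<open>One factor \<open>y i\<close> is moved from the product into \<open>p\<close>;
    the subtraction is exact since \<open>u\<close> has positive degree in the variable
    \<open>i\<close>.\<close>
  define w where "w = u - var_exp i"
  have u: "u = w + var_exp i"
    using i by (intro poly_mapping_eqI) (auto simp: w_def lookup_add lookup_minus lookup_single when_def)
  have "(\<Sum>j\<in>UNIV. Poly_Mapping.lookup (var_exp i) j) = (\<Sum>j\<in>UNIV. if j = i then 1 else (0::nat))"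
    by (intro sum.cong) (auto simp: lookup_single when_def)
  then have n: "n = (\<Sum>j\<in>UNIV. Poly_Mapping.lookup w j)"
    using Suc.hyps(2) by (simp add: u lookup_add sum.distrib)
  have "(\<Prod>j\<in>UNIV. y j ^ Poly_Mapping.lookup (var_exp i) j) = (\<Prod>j\<in>UNIV. if j = i then y j else 1)"
    by (intro prod.cong) (auto simp: lookup_single when_def)
  then have prod: "p * (\<Prod>j\<in>UNIV. y j ^ Poly_Mapping.lookup u j)
      = (p * y i) * (\<Prod>j\<in>UNIV. y j ^ Poly_Mapping.lookup w j)"
    by (simp add: u lookup_add power_add prod.distrib ac_simps)
  show ?case
    unfolding prod
  proof (rule Suc.hyps(1)[OF n])
    fix v assume "v \<in> Poly_Mapping.keys (p * y i)"
    then obtain s t where st: "s \<in> Poly_Mapping.keys p" "t \<in> Poly_Mapping.keys (y i)" and v: "v = s + t"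
      using keys_mult[of p "y i"] by blast
    have L: "(s + w) + var_exp i \<in> L"
      using Suc.prems[OF st(1)] by (simp add: u add.assoc)
    \<comment> \<open>A constant term of \<open>y i\<close> deletes the variable \<open>i\<close>,
      which closure under divisors permits; a term with \<open>j < i\<close> is a Borel move, and
      \<open>j = i\<close> leaves the monomial unchanged.\<close>
    have "t = 0 \<or> (\<exists>j\<le>i. t = var_exp j)"
      using y st(2) by blast
    then show "v + w \<in> L"
    proof (elim disjE exE conjE)
      assume "t = 0"
      then show ?thesis
        using div L unfolding closed_under_divisors_def monom_dvd_def v by (metis add.right_neutral)
    next
      fix j assume j: "j \<le> i" "t = var_exp j"
      have "monom_dvd (var_exp i) ((s + w) + var_exp i)"
        unfolding monom_dvd_def by (metis add.commute)
      then have "j < i \<Longrightarrow> (s + w) + var_exp i - var_exp i + var_exp j \<in> L"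
        using borel L unfolding borel_property_def by blast
      then have "(s + w) + var_exp j \<in> L"
        using L j(1) by (cases "j = i") auto
      then show ?thesis
        by (simp add: v j(2) ac_simps)
    qed
  qed
qed

text \<open>Lower triangularity restricts the \<open>i\<close>-th substituted form to a constant and
  variables with index at most \<open>i\<close>, as the preceding induction requires.\<close>

lemma keys_aff_mpol_Mono:
  fixes L :: "'n::{finite, linorder} monom set" and M :: "'a::comm_ring_1 ^ ('n::{finite, linorder}) ^ ('n::{finite, linorder})"
  assumes "closed_under_divisors L" and "borel_property L" and M: "lower_triangular M" and "u \<in> L"
  shows "Poly_Mapping.keys (aff_mpol M b (Mono u)) \<subseteq> L"
proof -
  let ?y = "\<lambda>i. (\<Sum>j\<in>UNIV. Const (M $ i $ j) * Var j) + Const (b $ i) :: ('n, 'a) mpol"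
  have "Poly_Mapping.keys (?y i) \<subseteq> insert 0 (var_exp ` {..i})" for i
  proof
    fix v assume "v \<in> Poly_Mapping.keys (?y i)"
    then consider "v \<in> Poly_Mapping.keys (\<Sum>j\<in>UNIV. Const (M $ i $ j) * Var j :: ('n, 'a) mpol)"
      | "v \<in> Poly_Mapping.keys (Const (b $ i))"
      using Poly_Mapping.keys_add[of "\<Sum>j\<in>UNIV. Const (M $ i $ j) * Var j"] by blast
    then show "v \<in> insert 0 (var_exp ` {..i})"
    proof cases
      case 1
      then obtain j where "v \<in> Poly_Mapping.keys (Poly_Mapping.single (var_exp j) (M $ i $ j))"
        using Poly_Mapping.keys_sum by (fastforce simp: Const_mult_Mono)
      then have "v = var_exp j" "M $ i $ j \<noteq> 0"
        by (auto split: if_splits)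
      moreover from this have "j \<le> i"
        using M by (meson lower_triangular_def not_le_imp_less)
      ultimately show ?thesis
        by blast
    next
      case 2
      then show ?thesis
        by (auto simp: Const_def split: if_splits)
    qed
  qed
  \<comment> \<open>Starting from \<open>p = 1\<close>, whose only exponent is \<open>0\<close>, the
    invariant is just \<open>u \<in> L\<close>.\<close>
  then have "Poly_Mapping.keys (1 * (\<Prod>i\<in>UNIV. ?y i ^ Poly_Mapping.lookup u i)) \<subseteq> L"
    using assms by (intro keys_mult_triangular_prod) auto
  then show ?thesis
    by (simp add: aff_mpol_def subst_mpol_def Mono_def Const_def)
qed

section \<open>The action on points\<close>

text \<open>Each coordinate of the image is a \<open>K\<close>-linear combination of elements of
  \<open>G\<close> plus an element of \<open>G\<close>, so the grid is mapped into itself;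
  invertibility of \<open>M\<close> gives injectivity.\<close>

lemma aff_point_image_cart_set:
  fixes G :: "'a::{field, finite} set" and M :: "'a ^ ('n::finite) ^ ('n::finite)"
  assumes G: "is_vector_space_over K G" and M: "\<forall>i j. M $ i $ j \<in> K" "invertible M"
    and b: "b \<in> cart_set (\<lambda>_. G)"
  shows "aff_point M b ` cart_set (\<lambda>_. G) = cart_set (\<lambda>_. G)"
proof (rule endo_inj_surj)
  have add: "0 \<in> G" "\<And>x y. x \<in> G \<Longrightarrow> y \<in> G \<Longrightarrow> x + y \<in> G"
    using G by (auto simp: is_vector_space_over_def add_subgroup_def)
  have sum: "(\<Sum>j\<in>S. f j) \<in> G" if "\<And>j. f j \<in> G" for f and S :: "'n set"
    by (induction S rule: infinite_finite_induct) (auto simp: add that)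
  have "aff_point M b P \<in> cart_set (\<lambda>_. G)" if P: "P \<in> cart_set (\<lambda>_. G)" for P
  proof -
    have "M $ i $ j * P $ j \<in> G" for i j
      using G M(1) P by (simp add: is_vector_space_over_def cart_set_def)
    then have "(M *v P) $ i \<in> G" for i
      by (simp add: matrix_vector_mult_def sum)
    then show ?thesis
      using b add(2) by (simp add: aff_point_def cart_set_def)
  qed
  then show "aff_point M b ` cart_set (\<lambda>_. G) \<subseteq> cart_set (\<lambda>_. G)"
    by blast
  have "inj ((*v) M)"
    using M(2) by (rule inj_matrix_vector_mult)
  then show "inj_on (aff_point M b) (cart_set (\<lambda>_. G))"
    by (auto simp: aff_point_def inj_on_def)
  show "finite (cart_set (\<lambda>_. G) :: ('a ^ 'n) set)"
    by simp
qed

theorem theorem4: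
  fixes G K :: "'a::{field, finite} set"
    and L :: "'n::{finite, linorder} monom set"
    and M :: "'a ^ ('n::{finite, linorder}) ^ ('n::{finite, linorder})"
    and b :: "'a ^ ('n::{finite, linorder})"
  assumes "add_subgroup G"
    and "card G \<ge> 2"
    and "largest_scalar_subfield K G"
    and "L \<subseteq> Delta (\<lambda>_. G)"
    and "closed_under_divisors L"
    and "borel_property L"
    and "b \<in> cart_set (\<lambda>_. G)"
    and "invertible M"
    and "lower_triangular M"
    and "\<forall>i j. M $ i $ j \<in> K"
  shows "(M, b) \<in> Perm_A (\<lambda>_. G) L"
proof -
  have "reduce (\<lambda>_. G) (aff_mpol M b (Mono u)) \<in> mpol_span (Mono ` L)" if "u \<in> L" for u
  proof -
    have "Poly_Mapping.keys (aff_mpol M b (Mono u)) \<subseteq> L"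
      using assms that by (intro keys_aff_mpol_Mono)
    \<comment> \<open>Since \<open>L\<close> lies in \<open>Delta\<close>, the support bound shows
      that the polynomial is already reduced.\<close>
    moreover from this have "reduce (\<lambda>_. G) (aff_mpol M b (Mono u)) = aff_mpol M b (Mono u)"
      using assms(4) by (intro reduce_eqI) auto
    ultimately show ?thesis
      by (simp add: mpol_span_Mono)
  qed
  moreover have "aff_point M b ` cart_set (\<lambda>_. G) = cart_set (\<lambda>_. G)"
    using assms by (intro aff_point_image_cart_set[of K]) (auto simp: largest_scalar_subfield_def)
  ultimately show ?thesis
    by (auto simp: Perm_A_def)
qed

end
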